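(* For every integer $n\ge2$, the punctured affine space $\mathbb{C}^n\setminus\{0\}$ does not satisfy the algebraic basic Oka property (aBOP).
   Context: An algebraic manifold is a smooth connected complex algebraic variety. An affine algebraic variety (over $\mathbb{C}$) used as a source need not be smooth or connected. A regular map is a morphism of algebraic varieties. An algebraic manifold $Y$ has the algebraic basic Oka property (aBOP) if, for every affine algebraic variety $X$, every continuous map $f\colon X\to Y$ is homotopic, in the Euclidean topology of complex points, to a regular map $g\colon X\to Y$. (Continuity of $f$ is also with respect to the Euclidean topology.) *)

theory Defs
  imports "HOL-Analysis.Analysis"
begin

text \<open>
  \<open>\<complex>\<^sup>m\<close> is encoded as the set of sequences vanishing from index \<open>m\<close> on, as in the library's
  \<open>Euclidean_space\<close>. This allows the dimension to be quantified inside a formula. The topology that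
  the type class provides on \<^typ>\<open>nat \<Rightarrow> complex\<close> is the product topology, so it induces the
  Euclidean topology on \<open>cspace m\<close> and on its subsets.
\<close>

definition cspace :: "nat \<Rightarrow> (nat \<Rightarrow> complex) set" where
  "cspace m = {x. \<forall>i\<ge>m. x i = 0}"

definition punctured_cspace :: "nat \<Rightarrow> (nat \<Rightarrow> complex) set" where
  "punctured_cspace n = cspace n - {\<lambda>_. 0}"

inductive_set poly_fun :: "nat \<Rightarrow> ((nat \<Rightarrow> complex) \<Rightarrow> complex) set" for m :: nat where
  const: "(\<lambda>_. c) \<in> poly_fun m"
| coord: "i < m \<Longrightarrow> (\<lambda>x. x i) \<in> poly_fun m"
| add: "p \<in> poly_fun m \<Longrightarrow> q \<in> poly_fun m \<Longrightarrow> (\<lambda>x. p x + q x) \<in> poly_fun m"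
| mult: "p \<in> poly_fun m \<Longrightarrow> q \<in> poly_fun m \<Longrightarrow> (\<lambda>x. p x * q x) \<in> poly_fun m"

definition zero_locus ::
  "nat \<Rightarrow> ((nat \<Rightarrow> complex) \<Rightarrow> complex) set \<Rightarrow> (nat \<Rightarrow> complex) set" where
  "zero_locus m S = {x \<in> cspace m. \<forall>p\<in>S. p x = 0}"

text \<open>
  Affine varieties are given by a closed embedding into some \<open>\<complex>\<^sup>m\<close>. They are reduced, but may be
  singular, reducible or disconnected.
\<close>

definition affine_variety :: "nat \<Rightarrow> (nat \<Rightarrow> complex) set \<Rightarrow> bool" where
  "affine_variety m X \<longleftrightarrow> (\<exists>S \<subseteq> poly_fun m. X = zero_locus m S)"

text \<open>
  Below, \<open>V\<close>, \<open>X\<close> and \<open>Y\<close> stand for quasi-affine varieties, that is, Zariski open subsets of closed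
  algebraic subsets of \<open>\<complex>\<^sup>m\<close> or \<open>\<complex>\<^sup>n\<close>. They carry the induced Zariski topology and the sheaf of
  functions that are locally quotients of polynomials.
\<close>

definition zariski_open :: "nat \<Rightarrow> (nat \<Rightarrow> complex) set \<Rightarrow> (nat \<Rightarrow> complex) set \<Rightarrow> bool" where
  "zariski_open m V U \<longleftrightarrow> (\<exists>S \<subseteq> poly_fun m. U = V - zero_locus m S)"

definition regular_fun ::
  "nat \<Rightarrow> (nat \<Rightarrow> complex) set \<Rightarrow> ((nat \<Rightarrow> complex) \<Rightarrow> complex) \<Rightarrow> bool" where
  "regular_fun m V h \<longleftrightarrow>
    (\<forall>a\<in>V. \<exists>U. zariski_open m V U \<and> a \<in> U \<and>
      (\<exists>p\<in>poly_fun m. \<exists>q\<in>poly_fun m. \<forall>x\<in>U. q x \<noteq> 0 \<and> h x = p x / q x))"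

definition regular_map ::
  "nat \<Rightarrow> (nat \<Rightarrow> complex) set \<Rightarrow> nat \<Rightarrow> (nat \<Rightarrow> complex) set \<Rightarrow>
    ((nat \<Rightarrow> complex) \<Rightarrow> nat \<Rightarrow> complex) \<Rightarrow> bool" where
  "regular_map m X n Y g \<longleftrightarrow>
    g \<in> X \<rightarrow> Y \<and>
    (\<forall>U. zariski_open n Y U \<longrightarrow>
      zariski_open m X (X \<inter> g -` U) \<and>
      (\<forall>h. regular_fun n U h \<longrightarrow> regular_fun m (X \<inter> g -` U) (h \<circ> g)))"

text \<open>
  The algebraic basic Oka property of a quasi-affine algebraic manifold \<open>Y \<subseteq> \<complex>\<^sup>n\<close>. Smoothness and
  connectedness of \<open>Y\<close> are deliberately not part of the predicate, so that its negation only
  denies that every continuous map is homotopic to a regular one.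
\<close>

definition aBOP :: "nat \<Rightarrow> (nat \<Rightarrow> complex) set \<Rightarrow> bool" where
  "aBOP n Y \<longleftrightarrow>
    (\<forall>m X f. affine_variety m X \<and> continuous_on X f \<and> f \<in> X \<rightarrow> Y \<longrightarrow>
      (\<exists>g. regular_map m X n Y g \<and> homotopic_with_canon (\<lambda>_. True) X Y f g))"

lemma zariski_open_punctured_cspace: "zariski_open n (cspace n) (punctured_cspace n)"
proof -
  have "punctured_cspace n = cspace n - zero_locus n ((\<lambda>i x. x i) ` {..<n})"
    by (auto simp: punctured_cspace_def cspace_def zero_locus_def fun_eq_iff)
      (metis lessThan_iff not_le)
  moreover have "(\<lambda>i x. x i) ` {..<n} \<subseteq> poly_fun n"
    by (auto intro: poly_fun.coord)
  ultimately show ?thesis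
    unfolding zariski_open_def by blast
qed

end

theory Submission
  imports Defs "HOL-Homology.Brouwer_Degree"
begin

text \<open>
  The source that violates the property is the algebraic torus \<open>X = (\<complex>\<^sup>*)\<^sup>N\<close> with \<open>N = 2n - 1\<close>. It
  deforms to the compact torus \<open>T\<close> of points whose coordinates have absolute value 1, and \<open>T\<close> has the
  same dimension as the unit sphere of \<open>\<complex>\<^sup>n\<close>.

  Every regular map \<open>g\<close> from \<open>X\<close> to \<open>\<complex>\<^sup>n - {0}\<close> is null-homotopic on \<open>T\<close>. Its first coordinate is a
  quotient of Laurent polynomials. On a compact torus \<open>\<bar>x i\<bar> = t powr w i\<close> with generic exponents
  \<open>w\<close> and large \<open>t\<close>, one monomial of a nonzero Laurent polynomial dominates the sum of all others, so
  this first coordinate has no zeros there, unless it vanishes identically.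
  In both cases the restriction of \<open>g\<close> contracts along straight lines to a constant
  (\<open>nullhomotopic_if_first_coordinate_zero_or_nonvanishing\<close>). All these compact tori are homotopic
  inside \<open>X\<close>, so \<open>g\<close> is null-homotopic on \<open>T\<close> as well
  (\<open>regular_map_nullhomotopic_on_unit_torus\<close>).

  On the other hand, there is a continuous map from \<open>T\<close> to \<open>\<complex>\<^sup>n - {0}\<close> that is not null-homotopic
  (\<open>centered_torus_map_essential\<close>): embed \<open>T\<close> as a hypersurface in \<open>\<real>\<^bsup>2n\<^esup> = \<complex>\<^sup>n\<close> and put the origin into
  the bounded component of the complement. A contraction would extend the identity
  near infinity to a nowhere vanishing map on all of \<open>\<real>\<^bsup>2n\<^esup>\<close>, which the Brouwer degree forbids.
  Composed with the retraction \<open>phases\<close> of \<open>X\<close> onto \<open>T\<close>, this map is not homotopic to a regular one.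
\<close>

section \<open>Homotopies between maps into coordinate spaces\<close>

lemma homotopic_with_canon_segment:
  fixes f g :: "'a::topological_space \<Rightarrow> 'i \<Rightarrow> 'b::real_normed_vector"
  assumes f: "continuous_on S f" and g: "continuous_on S g"
    and T: "\<And>t x. t \<in> {0..1} \<Longrightarrow> x \<in> S \<Longrightarrow> (\<lambda>i. (1 - t) *\<^sub>R f x i + t *\<^sub>R g x i) \<in> T"
  shows "homotopic_with_canon (\<lambda>_. True) S T f g"
proof -
  let ?h = "\<lambda>(t::real, x) i. (1 - t) *\<^sub>R f x i + t *\<^sub>R g x i"
  have f': "continuous_on S (\<lambda>x. f x i)" and g': "continuous_on S (\<lambda>x. g x i)" for i
    using f g by (auto intro: continuous_on_product_then_coordinatewise)
  have "continuous_on ({0..1} \<times> S) ?h"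
    unfolding case_prod_unfold
    by (intro continuous_on_coordinatewise_then_product continuous_on_add continuous_on_scaleR
        continuous_on_diff continuous_on_const continuous_on_fst continuous_on_id
        continuous_on_compose2[OF f', of _ snd] continuous_on_compose2[OF g', of _ snd]
        continuous_on_snd) auto
  moreover have "?h \<in> {0..1} \<times> S \<rightarrow> T"
    using T by auto
  ultimately show ?thesis
    unfolding homotopic_with_def prod_topology_subtopology_eu continuous_map_subtopology_eu
    by (intro exI[of _ ?h]) simp
qed

lemma homotopic_with_canonE:
  assumes "homotopic_with_canon (\<lambda>_. True) S T f g"
  obtains h where "continuous_on ({0..1::real} \<times> S) h" "h \<in> {0..1} \<times> S \<rightarrow> T"
    "\<And>x. h (0, x) = f x" "\<And>x. h (1, x) = g x"
  using assms unfolding homotopic_with_def prod_topology_subtopology_eu continuous_map_subtopology_eu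
  by blast

section \<open>Nowhere vanishing maps of Euclidean space\<close>

lemma nsphere_eq_top_of_set:
  "nsphere N = top_of_set {x. (\<Sum>i\<le>N. (x i)\<^sup>2) = 1 \<and> (\<forall>i>N. x i = 0)}"
  by (simp add: nsphere euclidean_product_topology)

text \<open>
  A form of the no-retraction theorem. Shrinking the sphere of a large radius \<open>L\<close> to the origin
  and following it by \<open>D\<close>, normalised, contracts the identity of the sphere to a constant. This
  contradicts the Brouwer degree: it is 1 for the identity and 0 for a constant.
\<close>

lemma nonvanishing_map_not_identity_near_infinity:
  fixes N :: nat and D :: "(nat \<Rightarrow> real) \<Rightarrow> nat \<Rightarrow> real"
  defines "E \<equiv> {y. \<forall>i>N. y i = 0}"
  assumes c: "c \<ge> 0"
    and cont: "continuous_on E D" and D: "D \<in> E \<rightarrow> E - {\<lambda>_. 0}"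
    and far: "\<And>y i. \<lbrakk>y \<in> E; i \<le> N; \<bar>y i\<bar> > c\<rbrakk> \<Longrightarrow> D y = y"
  shows False
proof -
  define S where "S = {x. (\<Sum>i\<le>N. (x i)\<^sup>2) = 1 \<and> (\<forall>i>N. (x i :: real) = 0)}"
  \<comment> \<open>A unit vector with \<open>N + 1\<close> coordinates has one of absolute value at least \<open>1 / sqrt (N + 1)\<close>,
      so this radius moves it beyond \<open>c\<close>.\<close>
  define L where "L = (c + 1) * (real N + 1)"
  define len :: "(nat \<Rightarrow> real) \<Rightarrow> real" where "len y = sqrt (\<Sum>i\<le>N. (y i)\<^sup>2)" for y
  let ?h = "\<lambda>(t, x) i. D (\<lambda>j. t * L * x j) i / len (D (\<lambda>j. t * L * x j))"
  have L: "L > 0"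
    using c by (auto simp: L_def)
  have len_pos: "len y > 0" if "y \<in> E - {\<lambda>_. 0}" for y
  proof -
    obtain i where "y i \<noteq> 0"
      using \<open>y \<in> E - _\<close> by auto
    then have "i \<le> N" using that by (auto simp: E_def intro: leI)
    then have "(\<Sum>i\<le>N. (y i)\<^sup>2) > 0"
      using \<open>y i \<noteq> 0\<close> by (intro sum_pos2[of _ i]) auto
    then show ?thesis by (simp add: len_def)
  qed
  have DE: "D (\<lambda>j. t * L * x j) \<in> E - {\<lambda>_. 0}" if "x \<in> S" for t x
    using that D by (auto simp: S_def E_def Pi_iff)
  have cont1: "continuous_on ({0..1} \<times> S) (\<lambda>p. D (\<lambda>j. fst p * L * snd p j) i)" for i
  proof (rule continuous_on_product_then_coordinatewise, rule continuous_on_compose2[OF cont])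
    show "continuous_on ({0..1} \<times> S) (\<lambda>p j. fst p * L * snd p j)"
      by (intro continuous_on_coordinatewise_then_product continuous_on_mult continuous_on_const
          continuous_on_fst continuous_on_id
          continuous_on_product_then_coordinatewise[OF continuous_on_snd])
  qed (auto simp: S_def E_def)
  have "continuous_on ({0..1} \<times> S) ?h"
    unfolding case_prod_unfold len_def
  proof (intro continuous_on_coordinatewise_then_product continuous_on_divide cont1
      continuous_on_real_sqrt continuous_on_sum continuous_on_power, safe)
    fix t :: real and x assume "x \<in> S" "sqrt (\<Sum>i\<le>N. (D (\<lambda>j. fst (t, x) * L * snd (t, x) j) i)\<^sup>2) = 0"
    then show False
      using len_pos[OF DE[of x t]] by (simp add: len_def)
  qed
  moreover have "?h (t, x) \<in> S" if "x \<in> S" for t x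
  proof -
    have "(len (D (\<lambda>j. t * L * x j)))\<^sup>2 = (\<Sum>i\<le>N. (D (\<lambda>j. t * L * x j) i)\<^sup>2)"
      by (simp add: len_def sum_nonneg)
    then have "(\<Sum>i\<le>N. (?h (t, x) i)\<^sup>2) = 1"
      using len_pos[OF DE[OF that, of t]]
      by (simp add: power_divide flip: sum_divide_distrib) (metis less_irrefl power_eq_0_iff)
    then show ?thesis
      using DE[OF that, of t] by (auto simp: S_def E_def)
  qed
  moreover have "?h (1, x) = x" if x: "x \<in> S" for x
  proof -
    have "\<exists>i\<le>N. \<bar>L * x i\<bar> > c"
    proof (rule ccontr)
      assume "\<not> ?thesis"
      then have le: "\<bar>L * x i\<bar> \<le> c" if "i \<le> N" for i
        using that by force
      have "(L * x i)\<^sup>2 \<le> c\<^sup>2" if "i \<le> N" for i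
        using le[OF that] c by (simp add: abs_le_square_iff[symmetric])
      then have "(\<Sum>i\<le>N. (L * x i)\<^sup>2) \<le> (\<Sum>i\<le>N. c\<^sup>2)"
        by (intro sum_mono) auto
      moreover have "(\<Sum>i\<le>N. (L * x i)\<^sup>2) = L\<^sup>2"
        using x by (simp add: S_def power_mult_distrib flip: sum_distrib_left)
      ultimately have "L\<^sup>2 \<le> (real N + 1) * c\<^sup>2"
        by (simp add: add.commute)
      moreover have "L\<^sup>2 = (real N + 1)\<^sup>2 * (c + 1)\<^sup>2"
        by (simp add: L_def power_mult_distrib mult.commute)
      moreover have "(real N + 1) * c\<^sup>2 < (real N + 1) * (c + 1)\<^sup>2"
        using c by (intro mult_strict_left_mono power_strict_mono) auto
      moreover have "(real N + 1) * (c + 1)\<^sup>2 \<le> (real N + 1)\<^sup>2 * (c + 1)\<^sup>2"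
        by (intro mult_right_mono zero_le_power2) (simp add: power2_eq_square)
      ultimately show False by linarith
    qed
    then have "D (\<lambda>j. L * x j) = (\<lambda>j. L * x j)"
      using x by (auto simp: S_def E_def intro!: far)
    moreover have "len (\<lambda>j. L * x j) = L"
      using x L by (simp add: S_def len_def power_mult_distrib flip: sum_distrib_left)
    ultimately show ?thesis
      using L by auto
  qed
  moreover have "?h (0, x) = ?h (0, \<lambda>_. 0)" for x
    by simp
  ultimately have "homotopic_with (\<lambda>_. True) (nsphere N) (nsphere N) (\<lambda>_. ?h (0, \<lambda>_. 0)) id"
    unfolding nsphere_eq_top_of_set S_def[symmetric]
    apply (subst homotopic_with, simp)
    unfolding prod_topology_subtopology_eu continuous_map_subtopology_eu
    by (intro exI[of _ ?h]) (simp add: Pi_iff split_paired_all)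
  from Brouwer_degree2_homotopic[OF this] show False
    by (simp add: Brouwer_degree2_const)
qed

section \<open>The torus as a hypersurface\<close>

definition unit_torus :: "nat \<Rightarrow> (nat \<Rightarrow> complex) set" where
  "unit_torus N = {\<theta>. (\<forall>i<N. cmod (\<theta> i) = 1) \<and> (\<forall>i\<ge>N. \<theta> i = 0)}"

text \<open>
  The radii decrease so fast that each exceeds the sum of all later ones. This keeps the iterated
  tubes below from meeting themselves.
\<close>

definition torus_radius :: "nat \<Rightarrow> real" where
  "torus_radius k = (1 / 3) ^ k"

text \<open>
  The \<open>N\<close>-dimensional torus sits in \<open>\<real>\<^bsup>N+1\<^esup>\<close> as the boundary of an iterated tube: \<open>nested_radius (k + 1)\<close>
  is the distance from the hypersurface \<open>nested_radius k = torus_radius k\<close>, measured in the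
  half-plane spanned by the previous radius and one new coordinate. For the point
  \<open>nested_radius 0 = 1\<close> of the line this gives a circle in the plane, then a torus of revolution in
  space, and so on. The direction of each of these plane vectors is an angle coordinate.
\<close>

primrec nested_radius :: "nat \<Rightarrow> (nat \<Rightarrow> real) \<Rightarrow> real" where
  "nested_radius 0 y = y 0"
| "nested_radius (Suc k) y = cmod (Complex (nested_radius k y - torus_radius k) (y (Suc k)))"

definition nested_angles :: "nat \<Rightarrow> (nat \<Rightarrow> real) \<Rightarrow> nat \<Rightarrow> complex" where
  "nested_angles N y k =
    (if k < N then sgn (Complex (nested_radius k y - torus_radius k) (y (Suc k))) else 0)"

text \<open>
  The inverse of the coordinates above: the point of \<open>\<real>\<^bsup>N+1\<^esup>\<close> whose angles are \<open>\<theta>\<close> and whose last nested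
  radius is \<open>\<rho>\<close>.
\<close>

primrec torus_point :: "nat \<Rightarrow> (nat \<Rightarrow> complex) \<Rightarrow> real \<Rightarrow> nat \<Rightarrow> real" where
  "torus_point 0 \<theta> \<rho> = (\<lambda>_. 0)(0 := \<rho>)"
| "torus_point (Suc k) \<theta> \<rho> =
    (torus_point k \<theta> (torus_radius k + \<rho> * Re (\<theta> k)))(Suc k := \<rho> * Im (\<theta> k))"

lemma torus_radius_pos: "torus_radius k > 0"
  and torus_radius_Suc: "torus_radius (Suc k) = torus_radius k / 3"
  and torus_radius_le_1: "torus_radius k \<le> 1"
  by (auto simp: torus_radius_def power_le_one)

lemma torus_point_eq_0: "i > N \<Longrightarrow> torus_point N \<theta> \<rho> i = 0"
  by (induction N arbitrary: \<rho>) auto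

lemma torus_point_cong:
  "(\<And>i. i < N \<Longrightarrow> \<theta> i = \<theta>' i) \<Longrightarrow> torus_point N \<theta> \<rho> = torus_point N \<theta>' \<rho>"
  by (induction N arbitrary: \<rho>) auto

lemma continuous_on_torus_point:
  assumes "continuous_on S r"
  shows "continuous_on S (\<lambda>\<theta>. torus_point N \<theta> (r \<theta>) i)"
  using assms
proof (induction N arbitrary: r)
  case 0
  then show ?case by (cases "i = 0") auto
next
  case (Suc N)
  have "continuous_on S (\<lambda>\<theta>. \<theta> N)"
    by (rule continuous_on_subset[OF continuous_on_product_coordinates]) auto
  then show ?case
    by (cases "i = Suc N") (auto intro!: Suc continuous_intros)
qed

lemma continuous_on_nested_radius: "continuous_on S (nested_radius k)"
proof (induction k)
  case (Suc k)
  have "continuous_on S (\<lambda>y. y (Suc k))"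
    by (rule continuous_on_subset[OF continuous_on_product_coordinates]) auto
  then show ?case
    using Suc by (auto simp: Complex_eq intro!: continuous_intros)
qed (auto intro: continuous_on_subset[OF continuous_on_product_coordinates])

lemma nested_radius_upd: "k < i \<Longrightarrow> nested_radius k (y(i := v)) = nested_radius k y"
  by (induction k) auto

text \<open>
  The bound on \<open>\<rho>\<close> makes every intermediate radius positive, so that taking norms recovers it with
  the right sign.
\<close>

lemma nested_radius_torus_point:
  assumes "\<And>i. i < N \<Longrightarrow> cmod (\<theta> i) = 1" "0 \<le> \<rho>" "\<rho> \<le> 3 / 2 * torus_radius N"
  shows "nested_radius N (torus_point N \<theta> \<rho>) = \<rho>"
  using assms
proof (induction N arbitrary: \<rho>)
  case (Suc N)
  \<comment> \<open>The next inner radius lies between one half and three halves of \<open>torus_radius N\<close>, because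
      \<open>\<rho>\<close> is at most one half of it.\<close>
  have "\<bar>\<rho> * Re (\<theta> N)\<bar> \<le> \<rho> * 1"
    unfolding abs_mult using Suc.prems abs_Re_le_cmod[of "\<theta> N"] by (intro mult_mono) auto
  then have "nested_radius N (torus_point N \<theta> (torus_radius N + \<rho> * Re (\<theta> N)))
      = torus_radius N + \<rho> * Re (\<theta> N)"
    using Suc.prems torus_radius_pos[of N]
    by (intro Suc.IH) (auto simp: torus_radius_Suc abs_le_iff)
  then have "nested_radius (Suc N) (torus_point (Suc N) \<theta> \<rho>) =
      cmod (complex_of_real \<rho> * \<theta> N)"
    by (simp add: nested_radius_upd del: fun_upd_apply) (simp add: cmod_def)
  then show ?case
    using Suc.prems by (simp add: norm_mult del: nested_radius.simps torus_point.simps)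
qed simp

text \<open>
  Norm times direction gives back each plane vector, also a zero one, whose direction is 0 by
  convention.
\<close>

lemma torus_point_nested_angles:
  assumes "N \<le> M" "\<And>i. i > N \<Longrightarrow> y i = 0"
  shows "torus_point N (nested_angles M y) (nested_radius N y) = y"
  using assms
proof (induction N arbitrary: y)
  case 0
  then show ?case by (auto simp: fun_eq_iff)
next
  case (Suc N)
  let ?u = "Complex (nested_radius N y - torus_radius N) (y (Suc N))"
  let ?y = "y(Suc N := 0)"
  have u: "complex_of_real (nested_radius (Suc N) y) * nested_angles M y N = ?u"
    using Suc.prems by (auto simp: nested_angles_def sgn_eq)
  have re: "torus_radius N + nested_radius (Suc N) y * Re (nested_angles M y N) = nested_radius N y"
    and im: "nested_radius (Suc N) y * Im (nested_angles M y N) = y (Suc N)"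
    using arg_cong[OF u, of Re] arg_cong[OF u, of Im] by simp_all
  have "torus_point N (nested_angles M y) (nested_radius N y) = ?y"
  proof -
    have "torus_point N (nested_angles M y) \<rho> = torus_point N (nested_angles M ?y) \<rho>" for \<rho>
      by (intro torus_point_cong) (auto simp: nested_angles_def nested_radius_upd)
    then show ?thesis
      using Suc.IH[of ?y] Suc.prems by (simp add: nested_radius_upd del: fun_upd_apply) (auto)
  qed
  then show ?case
    using re im by (simp del: nested_radius.simps)
qed

text \<open>
  Inside the tube all radii are controlled from the last one inwards: \<open>nested_radius k\<close> differs from
  \<open>torus_radius k\<close> by at most \<open>nested_radius (k + 1)\<close>.
\<close>

lemma nested_radius_bounds:
  assumes "nested_radius N y \<le> 3 / 2 * torus_radius N" 
  shows "k \<le> N \<Longrightarrow> nested_radius k y \<le> 3 / 2 * torus_radius k"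
    and "k < N \<Longrightarrow> torus_radius k / 2 \<le> nested_radius k y"
proof -
  have close: "\<bar>nested_radius k y - torus_radius k\<bar> \<le> torus_radius k / 2"
    if "nested_radius (Suc k) y \<le> 3 / 2 * torus_radius (Suc k)" for k
    using that abs_Re_le_cmod[of "Complex (nested_radius k y - torus_radius k) (y (Suc k))"]
    by (simp add: torus_radius_Suc)
  show *: "nested_radius k y \<le> 3 / 2 * torus_radius k" if "k \<le> N" for k
    using that
  proof (induction rule: inc_induct)
    case (step k)
    then show ?case using close[OF step.IH] by linarith
  qed (use assms in simp)
  show "torus_radius k / 2 \<le> nested_radius k y" if "k < N"
    using close[OF *[of "Suc k"]] that by linarith
qed

text \<open>
  A point on the core of the solid tube; for \<open>N > 0\<close> it is enclosed by the hypersurface.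
\<close>

definition torus_center :: "nat \<Rightarrow> nat \<Rightarrow> real" where
  "torus_center N = torus_point N (\<lambda>_. 1) 0"

lemma nested_radius_torus_center: "nested_radius N (torus_center N) = 0"
  unfolding torus_center_def using torus_radius_pos[of N]
  by (intro nested_radius_torus_point) auto

lemma abs_coordinate_le_of_nested_radius:
  assumes "nested_radius N y \<le> torus_radius N" "i \<le> N" "N > 0"
  shows "\<bar>y i\<bar> \<le> 3 / 2"
proof -
  have N: "nested_radius N y \<le> 3 / 2 * torus_radius N"
    using assms torus_radius_pos[of N] by linarith
  have "nested_radius i y \<le> 3 / 2"
    using nested_radius_bounds(1)[OF N \<open>i \<le> N\<close>] torus_radius_le_1[of i] by linarith
  moreover have "\<bar>y i\<bar> \<le> nested_radius i y"
  proof (cases i)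
    case 0
    then show ?thesis
      using nested_radius_bounds(2)[OF N, of 0] \<open>N > 0\<close> torus_radius_pos[of 0] by simp
  next
    case (Suc k)
    then show ?thesis
      using abs_Im_le_cmod[of "Complex (nested_radius k y - torus_radius k) (y (Suc k))"] by simp
  qed
  ultimately show ?thesis by linarith
qed

lemma nested_radius_Suc_pos:
  assumes "0 < nested_radius N y" "nested_radius N y \<le> torus_radius N" "k < N"
  shows "nested_radius (Suc k) y > 0"
proof (cases "Suc k = N")
  case False
  have N: "nested_radius N y \<le> 3 / 2 * torus_radius N"
    using assms torus_radius_pos[of N] by linarith
  show ?thesis
    using nested_radius_bounds(2)[OF N, of "Suc k"] torus_radius_pos[of "Suc k"] \<open>k < N\<close> False
    by linarith
qed (use assms in auto)

lemma continuous_on_nested_angles: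
  assumes "\<And>y. y \<in> S \<Longrightarrow> 0 < nested_radius N y \<and> nested_radius N y \<le> torus_radius N"
  shows "continuous_on S (nested_angles N)"
proof (rule continuous_on_coordinatewise_then_product)
  fix k
  have "Complex (nested_radius k y - torus_radius k) (y (Suc k)) \<noteq> 0" if "y \<in> S" "k < N" for y
    using nested_radius_Suc_pos[of N y k] assms that by auto
  moreover have "continuous_on S (\<lambda>y. Complex (nested_radius k y - torus_radius k) (y (Suc k)))"
    unfolding Complex_eq
    by (intro continuous_intros continuous_on_nested_radius
        continuous_on_product_then_coordinatewise[OF continuous_on_id])
  ultimately show "continuous_on S (\<lambda>y. nested_angles N y k)"
    by (cases "k < N") (auto simp: nested_angles_def sgn_div_norm intro!: continuous_intros)
qed

lemma nested_angles_in_unit_torus: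
  assumes "0 < nested_radius N y" "nested_radius N y \<le> torus_radius N"
  shows "nested_angles N y \<in> unit_torus N"
proof -
  have "Complex (nested_radius k y - torus_radius k) (y (Suc k)) \<noteq> 0" if "k < N" for k
    using nested_radius_Suc_pos[OF assms that] by auto
  then show ?thesis
    by (auto simp: unit_torus_def nested_angles_def norm_sgn)
qed

section \<open>An essential map from the torus to the sphere\<close>

definition centered_torus_map :: "nat \<Rightarrow> (nat \<Rightarrow> complex) \<Rightarrow> nat \<Rightarrow> real" where
  "centered_torus_map N \<theta> i = torus_point N \<theta> (torus_radius N) i - torus_center N i"

lemma continuous_on_centered_torus_map: "continuous_on S (centered_torus_map N)"
  unfolding centered_torus_map_def[abs_def]
  by (intro continuous_on_coordinatewise_then_product continuous_on_diff continuous_on_torus_point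
      continuous_on_const)

lemma centered_torus_map_nonzero:
  assumes "\<theta> \<in> unit_torus N"
  shows "centered_torus_map N \<theta> \<in> {y. \<forall>i>N. y i = 0} - {\<lambda>_. 0}"
proof -
  have "nested_radius N (torus_point N \<theta> (torus_radius N)) = torus_radius N"
    using assms torus_radius_pos[of N]
    by (intro nested_radius_torus_point) (auto simp: unit_torus_def)
  then have "torus_point N \<theta> (torus_radius N) \<noteq> torus_center N"
    using nested_radius_torus_center[of N] torus_radius_pos[of N] by auto
  then show ?thesis
    by (auto simp: centered_torus_map_def torus_center_def torus_point_eq_0 fun_eq_iff)
qed

text \<open>
  A closed hypersurface cannot be pulled away from a point that it encloses. From a contraction \<open>h\<close>
  one builds a nowhere vanishing self-map \<open>D\<close> of \<open>\<real>\<^bsup>N+1\<^esup>\<close>: the identity outside the tube, the contraction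
  \<open>h\<close> between the tube of full radius and the tube of half that radius, and the constant \<open>b\<close> inside
  the latter. Since the tube is bounded, this contradicts
  \<open>nonvanishing_map_not_identity_near_infinity\<close>.
\<close>

lemma centered_torus_map_essential:
  assumes "N > 0"
  shows "\<not> homotopic_with_canon (\<lambda>_. True) (unit_torus N) ({y. \<forall>i>N. y i = 0} - {\<lambda>_. 0})
    (centered_torus_map N) (\<lambda>_. b)"
proof
  let ?E = "{y :: nat \<Rightarrow> real. \<forall>i>N. y i = 0}"
  assume "homotopic_with_canon (\<lambda>_. True) (unit_torus N) (?E - {\<lambda>_. 0}) (centered_torus_map N) (\<lambda>_. b)"
  then obtain h where h: "continuous_on ({0..1::real} \<times> unit_torus N) h"
      "h \<in> {0..1} \<times> unit_torus N \<rightarrow> ?E - {\<lambda>_. 0}"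
      "\<And>\<theta>. h (0, \<theta>) = centered_torus_map N \<theta>" "\<And>\<theta>. h (1, \<theta>) = b"
    by (rule homotopic_with_canonE) blast
  define R where "R = torus_radius N"
  define shift where "shift y i = torus_center N i + y i" for y i
  define rad where "rad y = nested_radius N (shift y)" for y
  \<comment> \<open>The time of the contraction is 0 on the boundary of the tube and 1 at half the radius. Stopping
      there avoids the core, where the last angle is discontinuous.\<close>
  define mid where "mid y = h (2 - 2 * rad y / R, nested_angles N (shift y))" for y
  define D where "D y = (if rad y \<le> R then if rad y \<le> R / 2 then b else mid y else y)" for y
  have R: "R > 0"
    by (simp add: R_def torus_radius_pos)
  have b: "b \<in> ?E - {\<lambda>_. 0}"
  proof -
    have "(\<lambda>i. if i < N then 1 else 0) \<in> unit_torus N"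
      by (auto simp: unit_torus_def)
    then have "h (1, \<lambda>i. if i < N then 1 else 0) \<in> ?E - {\<lambda>_. 0}"
      by (intro funcset_mem[OF h(2)]) auto
    then show ?thesis by (simp add: h(4))
  qed
  have shift_E: "shift y \<in> ?E" if "y \<in> ?E" for y
    using that by (auto simp: shift_def torus_center_def torus_point_eq_0)
  have cont_shift: "continuous_on S shift" for S
    unfolding shift_def[abs_def]
    by (intro continuous_on_coordinatewise_then_product continuous_intros
        continuous_on_product_then_coordinatewise[OF continuous_on_id])
  have cont_rad: "continuous_on S rad" for S
    unfolding rad_def[abs_def]
    by (rule continuous_on_compose2[OF continuous_on_nested_radius[of UNIV] cont_shift]) auto
  have angles: "nested_angles N (shift y) \<in> unit_torus N" if "R / 2 \<le> rad y" "rad y \<le> R" for y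
    using that R by (intro nested_angles_in_unit_torus) (auto simp: rad_def R_def)
  have mid_E: "mid y \<in> ?E - {\<lambda>_. 0}" if "R / 2 \<le> rad y" "rad y \<le> R" for y
    unfolding mid_def using angles[OF that] that R
    by (intro funcset_mem[OF h(2)]) (auto simp: field_simps)
  have cont_mid: "continuous_on {y \<in> {y \<in> ?E. rad y \<le> R}. R / 2 \<le> rad y} mid"
    (is "continuous_on ?A mid")
    unfolding mid_def
  proof (rule continuous_on_compose2[OF h(1)])
    have "continuous_on (shift ` ?A) (nested_angles N)"
      using R by (intro continuous_on_nested_angles) (auto simp: rad_def R_def)
    then have "continuous_on ?A (\<lambda>y. nested_angles N (shift y))"
      by (rule continuous_on_compose2[OF _ cont_shift]) auto
    then show "continuous_on ?A (\<lambda>y. (2 - 2 * rad y / R, nested_angles N (shift y)))"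
      using R by (intro continuous_on_Pair continuous_on_diff continuous_on_divide continuous_on_mult
          continuous_on_const cont_rad) auto
    show "(\<lambda>y. (2 - 2 * rad y / R, nested_angles N (shift y))) ` ?A \<subseteq> {0..1} \<times> unit_torus N"
      using angles R by (auto simp: field_simps)
  qed
  have "continuous_on ?E D"
    unfolding D_def
  proof (intro continuous_on_cases_le cont_rad continuous_on_const continuous_on_id cont_mid)
    fix y assume y: "y \<in> {y \<in> ?E. rad y \<le> R}" "rad y = R / 2"
    have "2 - 2 * rad y / R = 1"
      unfolding y(2) using R by simp
    then show "b = mid y"
      by (simp add: mid_def h(4))
  next
    fix y assume y: "y \<in> ?E" "rad y = R"
    then have "torus_point N (nested_angles N (shift y)) R = shift y"
      using shift_E[OF y(1)] torus_point_nested_angles[of N N "shift y"] by (auto simp: rad_def)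
    then have "mid y = y"
      using y(2) R
      by (auto simp: mid_def h(3) centered_torus_map_def fun_eq_iff shift_def simp flip: R_def)
    then show "(if rad y \<le> R / 2 then b else mid y) = y"
      using y R by simp
  qed
  moreover have "D \<in> ?E \<rightarrow> ?E - {\<lambda>_. 0}"
  proof
    fix y assume y: "y \<in> ?E"
    show "D y \<in> ?E - {\<lambda>_. 0}"
    proof (cases "rad y \<le> R")
      case True
      then show ?thesis
        using b mid_E[of y] by (auto simp: D_def)
    next
      case False
      moreover have "rad (\<lambda>_. 0) = 0"
        using nested_radius_torus_center by (simp add: rad_def shift_def[abs_def])
      ultimately have "y \<noteq> (\<lambda>_. 0)"
        using R by auto
      then show ?thesis
        using False y by (auto simp: D_def)
    qed
  qed
  moreover have "D y = y" if y: "y \<in> ?E" "i \<le> N" "\<bar>y i\<bar> > 3" for y i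
  proof -
    have "\<not> rad y \<le> R"
    proof
      assume "rad y \<le> R"
      then have "\<bar>shift y i\<bar> \<le> 3 / 2"
        using y(2) \<open>N > 0\<close> unfolding rad_def R_def by (rule abs_coordinate_le_of_nested_radius)
      moreover have "\<bar>torus_center N i\<bar> \<le> 3 / 2"
        using y(2) \<open>N > 0\<close> torus_radius_pos[of N] nested_radius_torus_center[of N]
        by (intro abs_coordinate_le_of_nested_radius) auto
      ultimately show False
        using y(3) unfolding shift_def by linarith
    qed
    then show ?thesis by (simp add: D_def)
  qed
  ultimately show False
    by (intro nonvanishing_map_not_identity_near_infinity[of 3 N D]) auto
qed

section \<open>Laurent polynomials on the algebraic torus\<close>

text \<open>
  The variety \<open>(\<complex>\<^sup>*)\<^sup>N\<close> as a closed subvariety of \<open>\<complex>\<^bsup>2N\<^esup>\<close>, by adjoining the inverses of the coordinates.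
\<close>

definition algebraic_torus :: "nat \<Rightarrow> (nat \<Rightarrow> complex) set" where
  "algebraic_torus N = {x \<in> cspace (2 * N). \<forall>i<N. x i * x (N + i) = 1}"

lemma algebraic_torus_nonzero: "x \<in> algebraic_torus N \<Longrightarrow> i < N \<Longrightarrow> x i \<noteq> 0"
  by (auto simp: algebraic_torus_def)

lemma affine_variety_algebraic_torus: "affine_variety (2 * N) (algebraic_torus N)"
proof -
  let ?S = "(\<lambda>i x. x i * x (N + i) + - 1) ` {..<N}"
  have "?S \<subseteq> poly_fun (2 * N)"
  proof (safe)
    fix i assume "i < N"
    then show "(\<lambda>x. x i * x (N + i) + - 1) \<in> poly_fun (2 * N)"
      by (intro poly_fun.add poly_fun.mult poly_fun.coord poly_fun.const) auto
  qed
  moreover have "algebraic_torus N = zero_locus (2 * N) ?S"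
    by (auto simp: algebraic_torus_def zero_locus_def)
  ultimately show ?thesis
    unfolding affine_variety_def by blast
qed

definition monomial :: "nat \<Rightarrow> (nat \<Rightarrow> int) \<Rightarrow> (nat \<Rightarrow> complex) \<Rightarrow> complex" where
  "monomial N \<alpha> x = (\<Prod>i<N. x i powi \<alpha> i)"

text \<open>
  Zero coefficients are excluded, so that an empty exponent set is the only way to write the zero
  function and every exponent that occurs can be the dominating one.
\<close>

definition laurent_on_torus :: "nat \<Rightarrow> ((nat \<Rightarrow> complex) \<Rightarrow> complex) \<Rightarrow> bool" where
  "laurent_on_torus N F \<longleftrightarrow> (\<exists>A c. finite A \<and> (\<forall>\<alpha>\<in>A. c \<alpha> \<noteq> 0 \<and> (\<forall>i\<ge>N. \<alpha> i = 0)) \<and>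
    (\<forall>x\<in>algebraic_torus N. F x = (\<Sum>\<alpha>\<in>A. c \<alpha> * monomial N \<alpha> x)))"

text \<open>
  Cancelled terms may be present here; they are dropped from the exponent set.
\<close>

lemma laurent_on_torusI:
  assumes "finite A" "\<And>\<alpha> i. \<alpha> \<in> A \<Longrightarrow> i \<ge> N \<Longrightarrow> \<alpha> i = 0"
    "\<And>x. x \<in> algebraic_torus N \<Longrightarrow> F x = (\<Sum>\<alpha>\<in>A. c \<alpha> * monomial N \<alpha> x)"
  shows "laurent_on_torus N F"
proof -
  have "F x = (\<Sum>\<alpha>\<in>{\<alpha> \<in> A. c \<alpha> \<noteq> 0}. c \<alpha> * monomial N \<alpha> x)" if "x \<in> algebraic_torus N" for x
    unfolding assms(3)[OF that] using assms(1) by (intro sum.mono_neutral_right) auto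
  then show ?thesis
    unfolding laurent_on_torus_def using assms(1,2) by (intro exI[of _ "{\<alpha> \<in> A. c \<alpha> \<noteq> 0}"] exI[of _ c]) auto
qed

lemma laurent_on_torus_add:
  assumes "laurent_on_torus N F" "laurent_on_torus N G"
  shows "laurent_on_torus N (\<lambda>x. F x + G x)"
proof -
  obtain A c where A: "finite A" "\<forall>\<alpha>\<in>A. c \<alpha> \<noteq> 0 \<and> (\<forall>i\<ge>N. \<alpha> i = 0)"
      "\<forall>x\<in>algebraic_torus N. F x = (\<Sum>\<alpha>\<in>A. c \<alpha> * monomial N \<alpha> x)"
    using assms(1) unfolding laurent_on_torus_def by blast
  obtain B d where B: "finite B" "\<forall>\<alpha>\<in>B. d \<alpha> \<noteq> 0 \<and> (\<forall>i\<ge>N. \<alpha> i = 0)"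
      "\<forall>x\<in>algebraic_torus N. G x = (\<Sum>\<alpha>\<in>B. d \<alpha> * monomial N \<alpha> x)"
    using assms(2) unfolding laurent_on_torus_def by blast
  let ?e = "\<lambda>\<alpha>. (if \<alpha> \<in> A then c \<alpha> else 0) + (if \<alpha> \<in> B then d \<alpha> else 0)"
  show ?thesis
  proof (rule laurent_on_torusI[of "A \<union> B" N _ ?e])
    fix x assume x: "x \<in> algebraic_torus N"
    have "(\<Sum>\<alpha>\<in>A. c \<alpha> * monomial N \<alpha> x)
        = (\<Sum>\<alpha>\<in>A \<union> B. (if \<alpha> \<in> A then c \<alpha> else 0) * monomial N \<alpha> x)"
      using A(1) B(1) by (intro sum.mono_neutral_cong_left) auto
    moreover have "(\<Sum>\<alpha>\<in>B. d \<alpha> * monomial N \<alpha> x)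
        = (\<Sum>\<alpha>\<in>A \<union> B. (if \<alpha> \<in> B then d \<alpha> else 0) * monomial N \<alpha> x)"
      using A(1) B(1) by (intro sum.mono_neutral_cong_left) auto
    ultimately show "F x + G x = (\<Sum>\<alpha>\<in>A \<union> B. ?e \<alpha> * monomial N \<alpha> x)"
      using A(3) B(3) x by (simp add: distrib_right sum.distrib)
  qed (use A B in auto)
qed

lemma monomial_mult:
  assumes "x \<in> algebraic_torus N"
  shows "monomial N \<beta> x * monomial N \<alpha> x = monomial N (\<lambda>i. \<beta> i + \<alpha> i) x"
  unfolding monomial_def using algebraic_torus_nonzero[OF assms]
  by (subst prod.distrib[symmetric], intro prod.cong) (auto simp: power_int_add)

lemma laurent_on_torus_monomial_mult:
  assumes "laurent_on_torus N F" "\<And>i. i \<ge> N \<Longrightarrow> \<beta> i = 0"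
  shows "laurent_on_torus N (\<lambda>x. b * monomial N \<beta> x * F x)"
proof -
  obtain A c where A: "finite A" "\<forall>\<alpha>\<in>A. c \<alpha> \<noteq> 0 \<and> (\<forall>i\<ge>N. \<alpha> i = 0)"
      "\<forall>x\<in>algebraic_torus N. F x = (\<Sum>\<alpha>\<in>A. c \<alpha> * monomial N \<alpha> x)"
    using assms(1) unfolding laurent_on_torus_def by blast
  let ?s = "\<lambda>\<alpha> i. \<beta> i + \<alpha> i"
  have inj: "inj_on ?s A"
    by (auto simp: inj_on_def fun_eq_iff)
  show ?thesis
  proof (rule laurent_on_torusI[of "?s ` A" N _ "\<lambda>\<gamma>. b * c (\<lambda>i. \<gamma> i - \<beta> i)"])
    fix x assume x: "x \<in> algebraic_torus N"
    show "b * monomial N \<beta> x * F x = (\<Sum>\<gamma>\<in>?s ` A. b * c (\<lambda>i. \<gamma> i - \<beta> i) * monomial N \<gamma> x)"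
      using A(3) x
      by (simp add: sum.reindex[OF inj] sum_distrib_left monomial_mult[OF x, symmetric] mult_ac)
  qed (use A assms in auto)
qed

lemma laurent_on_torus_const: "laurent_on_torus N (\<lambda>_. b)"
  by (rule laurent_on_torusI[of "{\<lambda>_. 0}" N _ "\<lambda>_. b"]) (auto simp: monomial_def)

lemma laurent_on_torus_mult:
  assumes "laurent_on_torus N F" "laurent_on_torus N G"
  shows "laurent_on_torus N (\<lambda>x. F x * G x)"
proof -
  obtain A c where A: "finite A" "\<forall>\<alpha>\<in>A. c \<alpha> \<noteq> 0 \<and> (\<forall>i\<ge>N. \<alpha> i = 0)"
      "\<forall>x\<in>algebraic_torus N. F x = (\<Sum>\<alpha>\<in>A. c \<alpha> * monomial N \<alpha> x)"
    using assms(1) unfolding laurent_on_torus_def by blast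
  have "laurent_on_torus N (\<lambda>x. \<Sum>\<alpha>\<in>A. c \<alpha> * monomial N \<alpha> x * G x)"
    using A(1,2)
  proof (induction A rule: finite_induct)
    case empty
    then show ?case using laurent_on_torus_const[of N 0] by simp
  next
    case (insert \<alpha> A)
    then show ?case
      by (auto intro!: laurent_on_torus_add laurent_on_torus_monomial_mult assms)
  qed
  then show ?thesis
    unfolding laurent_on_torus_def using A(3) by (simp add: sum_distrib_right)
qed

lemma laurent_on_torus_coord:
  assumes "i < 2 * N"
  shows "laurent_on_torus N (\<lambda>x. x i)"
proof -
  define j where "j = (if i < N then i else i - N)"
  define e :: int where "e = (if i < N then 1 else - 1)"
  have j: "j < N"
    using assms by (auto simp: j_def)
  show ?thesis
  proof (rule laurent_on_torusI[of "{(\<lambda>_. 0)(j := e)}" N _ "\<lambda>_. 1"])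
    fix x assume x: "x \<in> algebraic_torus N"
    have "x i = x j powi e"
    proof (cases "i < N")
      case False
      then have "x j * x i = 1"
        using x assms by (auto simp: algebraic_torus_def j_def dest!: spec[of _ "i - N"])
      then show ?thesis
        using False by (simp add: e_def power_int_minus) (metis inverse_unique)
    qed (auto simp: j_def e_def)
    moreover have "monomial N ((\<lambda>_. 0)(j := e)) x = (\<Prod>k<N. if k = j then x j powi e else 1)"
      unfolding monomial_def by (intro prod.cong) auto
    ultimately show "x i = (\<Sum>\<alpha>\<in>{(\<lambda>_. 0)(j := e)}. 1 * monomial N \<alpha> x)"
      using j by simp
  qed (use j in auto)
qed

lemma laurent_on_torus_poly_fun: "F \<in> poly_fun (2 * N) \<Longrightarrow> laurent_on_torus N F"
  by (induction rule: poly_fun.induct)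
    (auto intro: laurent_on_torus_const laurent_on_torus_coord laurent_on_torus_add laurent_on_torus_mult)

text \<open>
  Weights \<open>w i = b ^ i\<close> work for all but finitely many \<open>b\<close>: two different exponents get the same
  weight only if \<open>b\<close> is a root of a nonzero polynomial.
\<close>

lemma separating_weights_exist:
  fixes A :: "(nat \<Rightarrow> int) set"
  assumes "finite A" "\<And>\<alpha> i. \<alpha> \<in> A \<Longrightarrow> i \<ge> N \<Longrightarrow> \<alpha> i = 0"
  shows "\<exists>w :: nat \<Rightarrow> real. inj_on (\<lambda>\<alpha>. \<Sum>i<N. w i * real_of_int (\<alpha> i)) A"
proof -
  define bad where "bad \<alpha> \<beta> = {b :: real. (\<Sum>i\<le>N. real_of_int (\<alpha> i - \<beta> i) * b ^ i) = 0}" for \<alpha> \<beta>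
  have "finite (bad \<alpha> \<beta>)" if "\<alpha> \<in> A" "\<beta> \<in> A" "\<alpha> \<noteq> \<beta>" for \<alpha> \<beta>
  proof -
    obtain i where "\<alpha> i \<noteq> \<beta> i"
      using \<open>\<alpha> \<noteq> \<beta>\<close> by auto
    moreover from this have "i \<le> N"
      using assms(2) that by (metis nat_le_linear)
    ultimately show ?thesis
      unfolding bad_def polyfun_finite_roots by (intro exI[of _ i]) auto
  qed
  then have "finite (\<Union>\<alpha>\<in>A. \<Union>\<beta>\<in>A - {\<alpha>}. bad \<alpha> \<beta>)"
    using assms(1) by auto
  then obtain b where b: "b \<notin> (\<Union>\<alpha>\<in>A. \<Union>\<beta>\<in>A - {\<alpha>}. bad \<alpha> \<beta>)"
    using ex_new_if_finite[OF infinite_UNIV_char_0] by blast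
  have "inj_on (\<lambda>\<alpha>. \<Sum>i<N. b ^ i * real_of_int (\<alpha> i)) A"
  proof (rule inj_onI, rule ccontr)
    fix \<alpha> \<beta> assume *: "\<alpha> \<in> A" "\<beta> \<in> A" "(\<Sum>i<N. b ^ i * real_of_int (\<alpha> i)) = (\<Sum>i<N. b ^ i * real_of_int (\<beta> i))"
      "\<alpha> \<noteq> \<beta>"
    have "(\<Sum>i\<le>N. real_of_int (\<alpha> i - \<beta> i) * b ^ i) = (\<Sum>i<N. real_of_int (\<alpha> i - \<beta> i) * b ^ i)"
      using assms(2)[OF *(1), of N] assms(2)[OF *(2), of N] by (simp add: lessThan_Suc_atMost[symmetric])
    also have "\<dots> = 0"
      using *(3) by (simp add: left_diff_distrib sum_subtractf mult.commute[of "real_of_int _"])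
    finally show False
      using b * by (auto simp: bad_def)
  qed
  then show ?thesis by blast
qed

lemma norm_monomial:
  assumes "t > 0" "\<And>i. i < N \<Longrightarrow> cmod (x i) = t powr w i"
  shows "cmod (monomial N \<alpha> x) = t powr (\<Sum>i<N. w i * real_of_int (\<alpha> i))"
proof -
  have "cmod (x i powi \<alpha> i) = t powr (w i * real_of_int (\<alpha> i))" if "i < N" for i
    using assms(1) assms(2)[OF that]
    by (simp add: norm_power_int powr_powr flip: powr_real_of_int')
  then show ?thesis
    using assms(1) by (simp add: monomial_def prod_norm[symmetric] powr_sum)
qed

text \<open>
  On the torus \<open>\<bar>x i\<bar> = t powr w i\<close> each monomial has constant absolute value, a power of \<open>t\<close>. The
  weights make these powers distinct, so for large \<open>t\<close> the largest term exceeds the sum of all others.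
\<close>

lemma laurent_sum_eventually_nonzero:
  assumes A: "finite A" "A \<noteq> {}" "\<And>\<alpha>. \<alpha> \<in> A \<Longrightarrow> c \<alpha> \<noteq> 0"
    and inj: "inj_on (\<lambda>\<alpha>. \<Sum>i<N. w i * real_of_int (\<alpha> i)) A"
  shows "\<forall>\<^sub>F t in at_top. \<forall>x. (\<forall>i<N. cmod (x i) = t powr w i) \<longrightarrow> (\<Sum>\<alpha>\<in>A. c \<alpha> * monomial N \<alpha> x) \<noteq> 0"
proof -
  define e where "e \<alpha> = (\<Sum>i<N. w i * real_of_int (\<alpha> i))" for \<alpha>
  obtain \<mu> where \<mu>: "\<mu> \<in> A" "\<And>\<alpha>. \<alpha> \<in> A \<Longrightarrow> e \<alpha> \<le> e \<mu>"
  proof -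
    have "Max (e ` A) \<in> e ` A"
      using A(1,2) by simp
    then obtain \<mu> where "\<mu> \<in> A" "e \<mu> = Max (e ` A)"
      by auto
    then show ?thesis
      using A(1) that by simp
  qed
  have lt: "e \<alpha> < e \<mu>" if "\<alpha> \<in> A - {\<mu>}" for \<alpha>
    using \<mu> inj that by (force simp: inj_on_def e_def[abs_def] less_le)
  have "((\<lambda>t. \<Sum>\<alpha>\<in>A - {\<mu>}. cmod (c \<alpha>) * t powr (e \<alpha> - e \<mu>)) \<longlongrightarrow> (\<Sum>\<alpha>\<in>A - {\<mu>}. cmod (c \<alpha>) * 0)) at_top"
    using lt by (intro tendsto_intros tendsto_neg_powr filterlim_ident) auto
  then have "\<forall>\<^sub>F t in at_top. (\<Sum>\<alpha>\<in>A - {\<mu>}. cmod (c \<alpha>) * t powr (e \<alpha> - e \<mu>)) < cmod (c \<mu>)"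
    using A(3)[OF \<mu>(1)] by (intro order_tendstoD(2)) auto
  then show ?thesis
    using eventually_gt_at_top[of 0]
  proof (eventually_elim, intro allI impI notI)
    fix t :: real and x
    assume small: "(\<Sum>\<alpha>\<in>A - {\<mu>}. cmod (c \<alpha>) * t powr (e \<alpha> - e \<mu>)) < cmod (c \<mu>)" and t: "t > 0"
      and x: "\<forall>i<N. cmod (x i) = t powr w i" and zero: "(\<Sum>\<alpha>\<in>A. c \<alpha> * monomial N \<alpha> x) = 0"
    have norm: "cmod (monomial N \<alpha> x) = t powr e \<alpha>" for \<alpha>
      using norm_monomial[OF t, of N x w] x by (simp add: e_def)
    have "c \<mu> * monomial N \<mu> x = - (\<Sum>\<alpha>\<in>A - {\<mu>}. c \<alpha> * monomial N \<alpha> x)"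
      using zero sum.remove[OF A(1) \<mu>(1), of "\<lambda>\<alpha>. c \<alpha> * monomial N \<alpha> x"]
      by (simp add: eq_neg_iff_add_eq_0)
    then have "cmod (c \<mu>) * t powr e \<mu> = cmod (\<Sum>\<alpha>\<in>A - {\<mu>}. c \<alpha> * monomial N \<alpha> x)"
      by (metis norm norm_minus_cancel norm_mult)
    also have "\<dots> \<le> (\<Sum>\<alpha>\<in>A - {\<mu>}. cmod (c \<alpha>) * t powr e \<alpha>)"
      by (rule order.trans[OF norm_sum]) (simp add: norm_mult norm)
    also have "\<dots> = (\<Sum>\<alpha>\<in>A - {\<mu>}. cmod (c \<alpha>) * t powr (e \<alpha> - e \<mu>)) * t powr e \<mu>"
      using t by (simp add: sum_distrib_right powr_diff)
    also have "\<dots> < cmod (c \<mu>) * t powr e \<mu>"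
      using small t by (intro mult_strict_right_mono) auto
    finally show False by simp
  qed
qed

section \<open>Regular functions on the algebraic torus\<close>

definition polytorus :: "nat \<Rightarrow> (nat \<Rightarrow> real) \<Rightarrow> (nat \<Rightarrow> complex) set" where
  "polytorus N r = {x \<in> algebraic_torus N. \<forall>i<N. cmod (x i) = r i}"

text \<open>
  One choice of weights separates the exponents of both functions, so common radii serve both.
\<close>

lemma polytorus_avoiding_zeros:
  assumes "F \<in> poly_fun (2 * N)" "G \<in> poly_fun (2 * N)"
  shows "\<exists>r. (\<forall>i. r i > 0) \<and>
    (\<forall>H\<in>{F, G}. (\<forall>x\<in>algebraic_torus N. H x = 0) \<or> (\<forall>x\<in>polytorus N r. H x \<noteq> 0))"
proof -
  obtain A c where A: "finite A" "\<forall>\<alpha>\<in>A. c \<alpha> \<noteq> 0 \<and> (\<forall>i\<ge>N. \<alpha> i = 0)"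
      "\<forall>x\<in>algebraic_torus N. F x = (\<Sum>\<alpha>\<in>A. c \<alpha> * monomial N \<alpha> x)"
    using laurent_on_torus_poly_fun[OF assms(1)] unfolding laurent_on_torus_def by blast
  obtain B d where B: "finite B" "\<forall>\<alpha>\<in>B. d \<alpha> \<noteq> 0 \<and> (\<forall>i\<ge>N. \<alpha> i = 0)"
      "\<forall>x\<in>algebraic_torus N. G x = (\<Sum>\<alpha>\<in>B. d \<alpha> * monomial N \<alpha> x)"
    using laurent_on_torus_poly_fun[OF assms(2)] unfolding laurent_on_torus_def by blast
  obtain w :: "nat \<Rightarrow> real" where w: "inj_on (\<lambda>\<alpha>. \<Sum>i<N. w i * real_of_int (\<alpha> i)) (A \<union> B)"
    using separating_weights_exist[of "A \<union> B" N] A B by blast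
  have *: "\<forall>\<^sub>F t in at_top. (\<forall>x\<in>algebraic_torus N. H x = 0) \<or>
      (\<forall>x\<in>polytorus N (\<lambda>i. t powr w i). H x \<noteq> 0)"
    if C: "finite C" "\<forall>\<alpha>\<in>C. e \<alpha> \<noteq> 0 \<and> (\<forall>i\<ge>N. \<alpha> i = 0)" "C \<subseteq> A \<union> B"
      "\<forall>x\<in>algebraic_torus N. H x = (\<Sum>\<alpha>\<in>C. e \<alpha> * monomial N \<alpha> x)" for C e H
  proof (cases "C = {}")
    case False
    have "\<forall>\<^sub>F t in at_top. \<forall>x. (\<forall>i<N. cmod (x i) = t powr w i) \<longrightarrow> (\<Sum>\<alpha>\<in>C. e \<alpha> * monomial N \<alpha> x) \<noteq> 0"
      using C False inj_on_subset[OF w] by (intro laurent_sum_eventually_nonzero) auto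
    then show ?thesis
      by eventually_elim (use C(4) in \<open>auto simp: polytorus_def\<close>)
  qed (use C in auto)
  have "\<forall>\<^sub>F t in at_top. t > (0::real) \<and>
     (\<forall>H\<in>{F, G}. (\<forall>x\<in>algebraic_torus N. H x = 0) \<or> (\<forall>x\<in>polytorus N (\<lambda>i. t powr w i). H x \<noteq> 0))"
    using *[OF A(1,2) Un_upper1 A(3)] *[OF B(1,2) Un_upper2 B(3)] eventually_gt_at_top[of 0]
    by eventually_elim blast
  then obtain t :: real where "t > 0"
     "\<forall>H\<in>{F, G}. (\<forall>x\<in>algebraic_torus N. H x = 0) \<or> (\<forall>x\<in>polytorus N (\<lambda>i. t powr w i). H x \<noteq> 0)"
    by (auto dest: eventually_happens)
  then show ?thesis
    by (intro exI[of _ "\<lambda>i. t powr w i"]) auto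
qed

text \<open>
  A regular function \<open>h\<close> satisfies an identity \<open>Q * h = P\<close> on the whole torus, with polynomials \<open>Q\<close>
  and \<open>P\<close> where \<open>Q\<close> is not identically zero: take one local representation \<open>p / q\<close> and multiply
  numerator and denominator by a polynomial \<open>s\<close> that vanishes off its domain. Choose a compact torus on
  which \<open>Q\<close> has no zero, and neither has \<open>P\<close> unless it is identically zero.
\<close>

lemma regular_fun_zero_or_nonvanishing_on_polytorus:
  assumes "regular_fun (2 * N) (algebraic_torus N) h"
  shows "\<exists>r. (\<forall>i. r i > 0) \<and> ((\<forall>x\<in>polytorus N r. h x = 0) \<or> (\<forall>x\<in>polytorus N r. h x \<noteq> 0))"
proof -
  let ?X = "algebraic_torus N"
  define a :: "nat \<Rightarrow> complex" where "a i = (if i < 2 * N then 1 else 0)" for i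
  have a: "a \<in> ?X"
    by (auto simp: a_def algebraic_torus_def cspace_def)
  then obtain U p q where U: "zariski_open (2 * N) ?X U" "a \<in> U"
    and pq: "p \<in> poly_fun (2 * N)" "q \<in> poly_fun (2 * N)" "\<And>x. x \<in> U \<Longrightarrow> q x \<noteq> 0 \<and> h x = p x / q x"
    using assms unfolding regular_fun_def by blast
  obtain S where S: "S \<subseteq> poly_fun (2 * N)" "U = ?X - zero_locus (2 * N) S"
    using U(1) unfolding zariski_open_def by blast
  then obtain s where s: "s \<in> S" "s a \<noteq> 0"
    using U(2) by (auto simp: zero_locus_def algebraic_torus_def)
  have eq: "s x * q x * h x = s x * p x" if "x \<in> ?X" for x
  proof (cases "s x = 0")
    case False
    then have "x \<in> U"
      using S(2) s(1) that by (auto simp: zero_locus_def)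
    then show ?thesis using pq(3) by auto
  qed auto
  have "(\<lambda>x. s x * q x) \<in> poly_fun (2 * N)" "(\<lambda>x. s x * p x) \<in> poly_fun (2 * N)"
    using S(1) s(1) pq by (auto intro: poly_fun.mult)
  from polytorus_avoiding_zeros[OF this] obtain r where r: "\<forall>i. r i > 0"
    "(\<forall>x\<in>?X. s x * q x = 0) \<or> (\<forall>x\<in>polytorus N r. s x * q x \<noteq> 0)"
    "(\<forall>x\<in>?X. s x * p x = 0) \<or> (\<forall>x\<in>polytorus N r. s x * p x \<noteq> 0)"
    by auto
  have sub: "polytorus N r \<subseteq> ?X"
    by (auto simp: polytorus_def)
  have "s a * q a \<noteq> 0"
    using s(2) pq(3)[OF U(2)] by auto
  then have q: "\<forall>x\<in>polytorus N r. s x * q x \<noteq> 0"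
    using r(2) a by blast
  have "(\<forall>x\<in>polytorus N r. h x = 0) \<or> (\<forall>x\<in>polytorus N r. h x \<noteq> 0)"
    using r(3)
  proof
    assume "\<forall>x\<in>?X. s x * p x = 0"
    then have "\<forall>x\<in>polytorus N r. h x = 0"
      using q eq sub by (metis mult_eq_0_iff subsetD)
    then show ?thesis ..
  next
    assume "\<forall>x\<in>polytorus N r. s x * p x \<noteq> 0"
    then have "\<forall>x\<in>polytorus N r. h x \<noteq> 0"
      using eq sub by (metis mult_zero_right subsetD)
    then show ?thesis ..
  qed
  with r(1) show ?thesis by blast
qed

section \<open>Regular maps from the algebraic torus to punctured affine space\<close>

text \<open>
  The straight line to a basis vector avoids the origin: the first basis vector if the first
  coordinate of \<open>k\<close> vanishes identically, the second one if it has no zeros. The second one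
  exists because \<open>n \<ge> 2\<close>.
\<close>

lemma nullhomotopic_if_first_coordinate_zero_or_nonvanishing:
  assumes "n \<ge> 2" and k: "continuous_on S k" "k \<in> S \<rightarrow> punctured_cspace n"
    and dich: "(\<forall>x\<in>S. k x 0 = 0) \<or> (\<forall>x\<in>S. k x 0 \<noteq> 0)"
  shows "\<exists>b. homotopic_with_canon (\<lambda>_. True) S (punctured_cspace n) k (\<lambda>_. b)"
proof -
  define j :: nat where "j = (if \<forall>x\<in>S. k x 0 = 0 then 0 else 1)"
  define b :: "nat \<Rightarrow> complex" where "b = (\<lambda>_. 0)(j := 1)"
  have "homotopic_with_canon (\<lambda>_. True) S (punctured_cspace n) k (\<lambda>_. b)"
  proof (rule homotopic_with_canon_segment[OF k(1) continuous_on_const])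
    fix t x assume t: "t \<in> {0..1::real}" and x: "x \<in> S"
    let ?p = "\<lambda>i. (1 - t) *\<^sub>R k x i + t *\<^sub>R b i"
    have kx: "k x \<in> cspace n" "k x \<noteq> (\<lambda>_. 0)"
      using k(2) x by (auto simp: punctured_cspace_def)
    have "?p \<in> cspace n"
      using kx(1) \<open>n \<ge> 2\<close> by (auto simp: cspace_def b_def j_def)
    moreover have "?p \<noteq> (\<lambda>_. 0)"
    proof
      assume p: "?p = (\<lambda>_. 0)"
      have p0: "(1 - t) *\<^sub>R k x 0 + t *\<^sub>R b 0 = 0" and pj: "(1 - t) *\<^sub>R k x j + t *\<^sub>R b j = 0"
        using fun_cong[OF p, of 0] fun_cong[OF p, of j] by simp_all
      show False
      proof (cases "\<forall>x\<in>S. k x 0 = 0")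
        case True
        then have "t = 0"
          using pj x by (auto simp: b_def j_def)
        then show False
          using p kx(2) by (simp add: fun_eq_iff)
      next
        case False
        then have "t = 1"
          using p0 x dich False by (auto simp: b_def j_def split: if_splits)
        then show False
          using pj by (simp add: b_def)
      qed
    qed
    ultimately show "?p \<in> punctured_cspace n"
      by (simp add: punctured_cspace_def)
  qed
  then show ?thesis by blast
qed

definition polytorus_point :: "nat \<Rightarrow> (nat \<Rightarrow> real) \<Rightarrow> (nat \<Rightarrow> complex) \<Rightarrow> nat \<Rightarrow> complex" where
  "polytorus_point N r \<theta> i =
    (if i < N then r i *\<^sub>R \<theta> i
     else if i < 2 * N then cnj (\<theta> (i - N)) /\<^sub>R r (i - N) else 0)"

lemma polytorus_point_in_polytorus:
  assumes "\<theta> \<in> unit_torus N" "\<And>i. r i > 0"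
  shows "polytorus_point N r \<theta> \<in> polytorus N r"
proof -
  have "\<theta> i * cnj (\<theta> i) = 1" if "i < N" for i
    using assms(1) that by (simp add: unit_torus_def complex_norm_square[symmetric])
  moreover have "r i \<noteq> 0" for i
    using assms(2)[of i] by simp
  ultimately show ?thesis
    using assms by (auto simp: polytorus_def algebraic_torus_def cspace_def polytorus_point_def
        unit_torus_def less_imp_le)
qed

text \<open>
  Geometric interpolation of the radii stays inside the algebraic torus.
\<close>

lemma homotopic_polytorus_points:
  assumes "\<And>i. r i > 0"
  shows "homotopic_with_canon (\<lambda>_. True) (unit_torus N) (algebraic_torus N)
    (polytorus_point N (\<lambda>_. 1)) (polytorus_point N r)"
proof -
  let ?h = "\<lambda>(s, \<theta>). polytorus_point N (\<lambda>i. r i powr s) \<theta>"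
  have "continuous_on ({0..1} \<times> unit_torus N) (\<lambda>p. polytorus_point N (\<lambda>i. r i powr fst p) (snd p) i)" for i
  proof -
    have pos: "r i \<noteq> 0" "\<not> r i < 0" for i
      using assms[of i] by auto
    have "continuous_on ({0..1::real} \<times> unit_torus N) (\<lambda>p. snd p j)" for j
      by (rule continuous_on_product_then_coordinatewise) (intro continuous_intros)
    then show ?thesis
      unfolding polytorus_point_def
      by (cases "i < N"; cases "i < 2 * N")
        (auto simp: pos intro!: continuous_on_scaleR continuous_on_powr continuous_on_inverse
          continuous_on_cnj continuous_on_const continuous_on_fst continuous_on_id)
  qed
  then have "continuous_on ({0..1} \<times> unit_torus N) ?h"
    unfolding case_prod_unfold by (rule continuous_on_coordinatewise_then_product)
  moreover have "?h \<in> {0..1} \<times> unit_torus N \<rightarrow> algebraic_torus N"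
  proof safe
    fix s :: real and \<theta> assume "\<theta> \<in> unit_torus N"
    then show "polytorus_point N (\<lambda>i. r i powr s) \<theta> \<in> algebraic_torus N"
      using polytorus_point_in_polytorus[of \<theta> N "\<lambda>i. r i powr s"] assms
      by (simp add: polytorus_def less_imp_neq[THEN not_sym])
  qed
  moreover have "?h (0, \<theta>) = polytorus_point N (\<lambda>_. 1) \<theta>" "?h (1, \<theta>) = polytorus_point N r \<theta>" for \<theta>
    using assms by (auto simp: less_imp_neq[symmetric] less_imp_le)
  ultimately show ?thesis
    unfolding homotopic_with_def prod_topology_subtopology_eu continuous_map_subtopology_eu
    by (intro exI[of _ ?h]) simp
qed

lemma regular_fun_first_coordinate:
  assumes "regular_map m X n (punctured_cspace n) g" "n > 0"
  shows "regular_fun m X (\<lambda>x. g x 0)"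
proof -
  let ?Y = "punctured_cspace n"
  have "?Y - zero_locus n {\<lambda>_. 1} = ?Y"
    by (simp add: zero_locus_def)
  then have Y: "zariski_open n ?Y ?Y"
    unfolding zariski_open_def by (intro exI[of _ "{\<lambda>_. 1}"]) (auto intro: poly_fun.const)
  have "regular_fun n ?Y (\<lambda>x. x 0)"
    unfolding regular_fun_def
  proof
    fix a assume "a \<in> ?Y"
    moreover have "\<exists>p\<in>poly_fun n. \<exists>q\<in>poly_fun n. \<forall>x\<in>?Y. q x \<noteq> 0 \<and> x 0 = p x / q x"
      using assms(2)
      by (intro bexI[of _ "\<lambda>x. x 0"] bexI[of _ "\<lambda>_. 1"]) (auto intro: poly_fun.const poly_fun.coord)
    ultimately show "\<exists>U. zariski_open n ?Y U \<and> a \<in> U \<and>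
        (\<exists>p\<in>poly_fun n. \<exists>q\<in>poly_fun n. \<forall>x\<in>U. q x \<noteq> 0 \<and> x 0 = p x / q x)"
      using Y by blast
  qed
  then have "regular_fun m (X \<inter> g -` ?Y) ((\<lambda>x. x 0) \<circ> g)"
    using assms(1) Y unfolding regular_map_def by blast
  moreover have "X \<inter> g -` ?Y = X"
    using assms(1) unfolding regular_map_def by auto
  ultimately show ?thesis
    by (simp add: comp_def)
qed

text \<open>
  Move the unit torus to a polytorus on which the first coordinate of \<open>g\<close> has no zeros or vanishes
  identically. On that polytorus the map contracts, and all polytori are homotopic.
\<close>

lemma regular_map_nullhomotopic_on_unit_torus:
  assumes "n \<ge> 2" and g: "regular_map (2 * N) (algebraic_torus N) n (punctured_cspace n) g"
    and cont: "continuous_on (algebraic_torus N) g"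
  shows "\<exists>b. homotopic_with_canon (\<lambda>_. True) (unit_torus N) (punctured_cspace n)
    (g \<circ> polytorus_point N (\<lambda>_. 1)) (\<lambda>_. b)"
proof -
  let ?Y = "punctured_cspace n"
  have gY: "g \<in> algebraic_torus N \<rightarrow> ?Y"
    using g by (simp add: regular_map_def)
  have "regular_fun (2 * N) (algebraic_torus N) (\<lambda>x. g x 0)"
    using g \<open>n \<ge> 2\<close> by (intro regular_fun_first_coordinate) auto
  then obtain r where r: "\<And>i. r i > 0"
      "(\<forall>x\<in>polytorus N r. g x 0 = 0) \<or> (\<forall>x\<in>polytorus N r. g x 0 \<noteq> 0)"
    using regular_fun_zero_or_nonvanishing_on_polytorus by meson
  have hom: "homotopic_with_canon (\<lambda>_. True) (unit_torus N) ?Y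
      (g \<circ> polytorus_point N (\<lambda>_. 1)) (g \<circ> polytorus_point N r)"
    using homotopic_polytorus_points[OF r(1)] cont gY
    by (rule homotopic_with_compose_continuous_left)
  have "\<exists>b. homotopic_with_canon (\<lambda>_. True) (unit_torus N) ?Y (g \<circ> polytorus_point N r) (\<lambda>_. b)"
  proof (rule nullhomotopic_if_first_coordinate_zero_or_nonvanishing[OF \<open>n \<ge> 2\<close>])
    show "continuous_on (unit_torus N) (g \<circ> polytorus_point N r)"
      "g \<circ> polytorus_point N r \<in> unit_torus N \<rightarrow> ?Y"
      using homotopic_with_imp_continuous[OF hom] homotopic_with_imp_funspace2[OF hom] by auto
    show "(\<forall>\<theta>\<in>unit_torus N. (g \<circ> polytorus_point N r) \<theta> 0 = 0) \<or>
        (\<forall>\<theta>\<in>unit_torus N. (g \<circ> polytorus_point N r) \<theta> 0 \<noteq> 0)"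
      using r polytorus_point_in_polytorus[of _ N r] by auto
  qed
  with hom show ?thesis
    using homotopic_with_trans by blast
qed

section \<open>Real and complex coordinates\<close>

definition complexify :: "(nat \<Rightarrow> real) \<Rightarrow> nat \<Rightarrow> complex" where
  "complexify y j = Complex (y (2 * j)) (y (2 * j + 1))"

definition realify :: "(nat \<Rightarrow> complex) \<Rightarrow> nat \<Rightarrow> real" where
  "realify z i = (if even i then Re (z (i div 2)) else Im (z (i div 2)))"

lemma realify_complexify: "realify (complexify y) = y"
  by (auto simp: realify_def complexify_def fun_eq_iff elim!: oddE)

lemma continuous_on_complexify: "continuous_on S complexify"
  unfolding complexify_def[abs_def] Complex_eq
  by (intro continuous_on_coordinatewise_then_product continuous_intros
      continuous_on_product_then_coordinatewise[OF continuous_on_id])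

lemma continuous_on_realify: "continuous_on S realify"
proof -
  have "continuous_on S (\<lambda>z. realify z i)" for i
    unfolding realify_def
    by (cases "even i") (auto intro!: continuous_on_Re continuous_on_Im
      continuous_on_product_then_coordinatewise[OF continuous_on_id])
  then show ?thesis by (rule continuous_on_coordinatewise_then_product)
qed

lemma complexify_punctured:
  assumes "n \<ge> 1"
  shows "complexify \<in> ({y. \<forall>i>2 * n - 1. y i = 0} - {\<lambda>_. 0}) \<rightarrow> punctured_cspace n"
proof
  fix y :: "nat \<Rightarrow> real" assume y: "y \<in> {y. \<forall>i>2 * n - 1. y i = 0} - {\<lambda>_. 0}"
  have "complexify y \<noteq> (\<lambda>_. 0)"
  proof
    assume "complexify y = (\<lambda>_. 0)"
    then have "realify (complexify y) = (\<lambda>_. 0)"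
      by (simp add: realify_def fun_eq_iff)
    then show False using y by (simp add: realify_complexify)
  qed
  then show "complexify y \<in> punctured_cspace n"
    using y assms by (auto simp: punctured_cspace_def cspace_def complexify_def complex_eq_iff)
qed

lemma realify_punctured:
  "realify \<in> punctured_cspace n \<rightarrow> ({y. \<forall>i>2 * n - 1. y i = 0} - {\<lambda>_. 0})"
proof
  fix z assume z: "z \<in> punctured_cspace n"
  then obtain j where "z j \<noteq> 0"
    by (auto simp: punctured_cspace_def)
  then have "realify z (2 * j) \<noteq> 0 \<or> realify z (2 * j + 1) \<noteq> 0"
    by (auto simp: realify_def complex_eq_iff)
  then have "realify z \<noteq> (\<lambda>_. 0)"
    by (auto simp: fun_eq_iff)
  moreover have "realify z i = 0" if "i > 2 * n - 1" for i
  proof -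
    have "i div 2 \<ge> n"
      using that by linarith
    then show ?thesis
      using z by (simp add: realify_def punctured_cspace_def cspace_def)
  qed
  ultimately show "realify z \<in> {y. \<forall>i>2 * n - 1. y i = 0} - {\<lambda>_. 0}"
    by simp
qed

section \<open>A continuous map that is not homotopic to a regular one\<close>

definition phases :: "nat \<Rightarrow> (nat \<Rightarrow> complex) \<Rightarrow> nat \<Rightarrow> complex" where
  "phases N x i = (if i < N then sgn (x i) else 0)"

lemma continuous_on_phases: "continuous_on (algebraic_torus N) (phases N)"
proof -
  have "continuous_on (algebraic_torus N) (\<lambda>x. phases N x i)" for i
  proof (cases "i < N")
    case True
    have "continuous_on (algebraic_torus N) (\<lambda>x. x i)"
      by (rule continuous_on_product_then_coordinatewise[OF continuous_on_id])
    then have "continuous_on (algebraic_torus N) (\<lambda>x. x i /\<^sub>R cmod (x i))"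
      using algebraic_torus_nonzero[OF _ True]
      by (intro continuous_on_scaleR continuous_on_inverse continuous_on_norm) auto
    with True show ?thesis
      by (simp add: phases_def sgn_div_norm)
  qed (simp add: phases_def)
  then show ?thesis by (rule continuous_on_coordinatewise_then_product)
qed

lemma phases_in_unit_torus: "phases N \<in> algebraic_torus N \<rightarrow> unit_torus N"
  using algebraic_torus_nonzero by (auto simp: phases_def unit_torus_def norm_sgn)

lemma phases_polytorus_point:
  "\<theta> \<in> unit_torus N \<Longrightarrow> phases N (polytorus_point N (\<lambda>_. 1) \<theta>) = \<theta>"
  by (auto simp: phases_def polytorus_point_def unit_torus_def fun_eq_iff sgn_div_norm)

theorem theorem1p8:
  fixes n :: nat
  assumes "n \<ge> 2"
  shows "\<not> aBOP n (punctured_cspace n)"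
proof
  assume aBOP: "aBOP n (punctured_cspace n)"
  \<comment> \<open>The dimension of the unit sphere of \<open>\<complex>\<^sup>n\<close>.\<close>
  define N where "N = 2 * n - 1"
  let ?X = "algebraic_torus N" and ?T = "unit_torus N" and ?Y = "punctured_cspace n"
  let ?E = "{y :: nat \<Rightarrow> real. \<forall>i>N. y i = 0} - {\<lambda>_. 0}"
  let ?p = "polytorus_point N (\<lambda>_. 1)"
  define e where "e = complexify \<circ> centered_torus_map N"
  define f where "f = e \<circ> phases N"
  have N: "N > 0"
    using assms by (simp add: N_def)
  have e_cont: "continuous_on S e" for S
    unfolding e_def
    by (intro continuous_on_compose continuous_on_centered_torus_map continuous_on_complexify)
  have e_Y: "e \<theta> \<in> ?Y" if "\<theta> \<in> ?T" for \<theta>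
    using funcset_mem[OF complexify_punctured[of n] centered_torus_map_nonzero[OF that, unfolded N_def]]
      assms by (simp add: e_def N_def)
  have "continuous_on ?X f"
    unfolding f_def by (intro continuous_on_compose continuous_on_phases e_cont)
  moreover have "f \<in> ?X \<rightarrow> ?Y"
    using e_Y funcset_mem[OF phases_in_unit_torus] by (simp add: f_def)
  ultimately obtain g where g: "regular_map (2 * N) ?X n ?Y g"
      "homotopic_with_canon (\<lambda>_. True) ?X ?Y f g"
    using aBOP affine_variety_algebraic_torus unfolding aBOP_def by blast
  have p: "continuous_on ?T ?p" "?p \<in> ?T \<rightarrow> ?X"
    using homotopic_polytorus_points[of "\<lambda>_. 1" N]
    by (auto dest: homotopic_with_imp_continuous homotopic_with_imp_funspace1)
  obtain b where b: "homotopic_with_canon (\<lambda>_. True) ?T ?Y (g \<circ> ?p) (\<lambda>_. b)"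
    using regular_map_nullhomotopic_on_unit_torus[OF assms g(1)]
      homotopic_with_imp_continuous[OF g(2)] by blast
  have "homotopic_with_canon (\<lambda>_. True) ?T ?Y (f \<circ> ?p) (g \<circ> ?p)"
    using g(2) p by (rule homotopic_with_compose_continuous_right)
  then have "homotopic_with_canon (\<lambda>_. True) ?T ?Y (f \<circ> ?p) (\<lambda>_. b)"
    using b by (rule homotopic_with_trans)
  then have "homotopic_with_canon (\<lambda>_. True) ?T ?E (realify \<circ> (f \<circ> ?p)) (realify \<circ> (\<lambda>_. b))"
    by (rule homotopic_with_compose_continuous_left[OF _ continuous_on_realify])
      (use realify_punctured[of n] in \<open>simp add: N_def\<close>)
  then have "homotopic_with_canon (\<lambda>_. True) ?T ?E (centered_torus_map N) (\<lambda>_. realify b)"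
    by (rule homotopic_with_eq) (auto simp: f_def e_def phases_polytorus_point realify_complexify)
  then show False
    using centered_torus_map_essential[OF N] by blast
qed

end
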